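(* Let $X$ and $Y$ be compact metric spaces, $G$ a closed relation on $X$ and $H$ a closed relation on $Y$. If $G$ and $H$ are topological conjugates, then $\mathrm{ent}(G)=\mathrm{ent}(H)$ and $\star_{i=1}^{\infty}G^{-1}$ is homeomorphic to $\star_{i=1}^{\infty}H^{-1}$.
   Context: A closed relation on a compact metric space $X$ is a closed subset $G\subseteq X\times X$. Closed relations $G$ on $X$ and $H$ on $Y$ are topological conjugates if there is a homeomorphism $\varphi:X\to Y$ such that for each $(x,y)\in X\times X$: $(x,y)\in G\iff(\varphi(x),\varphi(y))\in H$. For a positive integer $m$, $\star_{i=1}^{m}G^{-1}=\{(x_1,\dots,x_{m+1})\in X^{m+1} : (x_{i+1},x_i)\in G \text{ for } i=1,\dots,m\}$, and $\star_{i=1}^{\infty}G^{-1}=\{(x_1,x_2,\dots)\in\prod_{i=1}^\infty X : (x_{i+1},x_i)\in G\text{ for all }i\ge1\}$ (with the subspace topology of the product topology). For an open cover $\alpha$ of $X$, $\alpha^{n}=\{A_1\times\dots\times A_n : A_j\in\alpha\}$, and for closed $K\subseteq X^n$, $N(K,\alpha^n)$ is the minimal cardinality of a subfamily of $\alpha^n$ whose union contains $K$. For $G\ne\emptyset$, $\mathrm{ent}(G,\alpha)=\lim_{m\to\infty}\frac{1}{m}\log N(\star_{i=1}^mG^{-1},\alpha^{m+1})$ (convention: $\log 0:=0$, relevant only if a Mahavier product is empty; the limit exists). The entropy is $\mathrm{ent}(G)=\sup_\alpha\mathrm{ent}(G,\alpha)\in[0,\infty]$ over all open covers $\alpha$ of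 $X$ if $G\neq\emptyset$, and $\mathrm{ent}(\emptyset)=0$. *)

theory Defs
  imports "HOL-Analysis.Analysis"
begin

text \<open>
  A compact metric space is a value \<open>X :: 'a metric\<close> whose topology \<open>mtopology_of X\<close> is compact.
  Conjugacy, Mahavier products and entropy depend on the metric only through this topology, so
  they are defined for an arbitrary \<open>T :: 'a topology\<close>.
\<close>

definition closed_relation :: "'a topology \<Rightarrow> ('a \<times> 'a) set \<Rightarrow> bool" where
  "closed_relation T G \<longleftrightarrow> closedin (prod_topology T T) G"

definition topological_conjugates ::
  "'a topology \<Rightarrow> ('a \<times> 'a) set \<Rightarrow> 'b topology \<Rightarrow> ('b \<times> 'b) set \<Rightarrow> bool" where
  "topological_conjugates T G S H \<longleftrightarrow>
     (\<exists>\<phi>. homeomorphic_map T S \<phi> \<and>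
          (\<forall>x\<in>topspace T. \<forall>y\<in>topspace T. (x, y) \<in> G \<longleftrightarrow> (\<phi> x, \<phi> y) \<in> H))"

text \<open>
  Points of \<open>X\<^sup>n\<close> are the functions in \<open>{1..n} \<rightarrow>\<^sub>E topspace T\<close>, and points of the infinite
  product are those in \<open>{1..} \<rightarrow>\<^sub>E topspace T\<close>; this is the carrier of \<^const>\<open>product_topology\<close>.
\<close>

definition mahavier_inv :: "'a topology \<Rightarrow> ('a \<times> 'a) set \<Rightarrow> nat \<Rightarrow> (nat \<Rightarrow> 'a) set" where
  "mahavier_inv T G m =
     {x \<in> {1..m+1} \<rightarrow>\<^sub>E topspace T. \<forall>i\<in>{1..m}. (x (i+1), x i) \<in> G}"

definition mahavier_inv_inf :: "'a topology \<Rightarrow> ('a \<times> 'a) set \<Rightarrow> (nat \<Rightarrow> 'a) set" where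
  "mahavier_inv_inf T G =
     {x \<in> {1..} \<rightarrow>\<^sub>E topspace T. \<forall>i\<ge>1. (x (i+1), x i) \<in> G}"

definition mahavier_inv_inf_topology :: "'a topology \<Rightarrow> ('a \<times> 'a) set \<Rightarrow> (nat \<Rightarrow> 'a) topology" where
  "mahavier_inv_inf_topology T G =
     subtopology (product_topology (\<lambda>_. T) {1..}) (mahavier_inv_inf T G)"

definition open_cover :: "'a topology \<Rightarrow> 'a set set \<Rightarrow> bool" where
  "open_cover T \<alpha> \<longleftrightarrow> (\<forall>A\<in>\<alpha>. openin T A) \<and> \<Union>\<alpha> = topspace T"

definition cover_power :: "'a set set \<Rightarrow> nat \<Rightarrow> (nat \<Rightarrow> 'a) set set" where
  "cover_power \<alpha> n = {PiE {1..n} A | A. \<forall>j\<in>{1..n}. A j \<in> \<alpha>}"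

text \<open>
  The minimum may be taken over finite subfamilies only: when \<open>T\<close> is compact, \<open>\<alpha>\<close> is an open
  cover and \<open>K\<close> is closed, a finite subfamily covering \<open>K\<close> exists.
\<close>

definition min_subcover :: "(nat \<Rightarrow> 'a) set \<Rightarrow> (nat \<Rightarrow> 'a) set set \<Rightarrow> nat" where
  "min_subcover K \<C> = (LEAST k. \<exists>\<B>. \<B> \<subseteq> \<C> \<and> finite \<B> \<and> card \<B> = k \<and> K \<subseteq> \<Union>\<B>)"

text \<open>
  The convention \<open>log 0 = 0\<close> is built into the library, where \<open>ln (0::real) = 0\<close>. The junk term at
  \<open>m = 0\<close> does not affect the limit.
\<close>

definition ent_cover :: "'a topology \<Rightarrow> ('a \<times> 'a) set \<Rightarrow> 'a set set \<Rightarrow> real" where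
  "ent_cover T G \<alpha> =
     lim (\<lambda>m. 1 / real m * ln (real (min_subcover (mahavier_inv T G m) (cover_power \<alpha> (m+1)))))"

definition ent :: "'a topology \<Rightarrow> ('a \<times> 'a) set \<Rightarrow> ereal" where
  "ent T G = (if G = {} then 0 else (SUP \<alpha>\<in>{\<alpha>. open_cover T \<alpha>}. ereal (ent_cover T G \<alpha>)))"

end

theory Submission
  imports Defs
begin

text \<open>
  Everything here is built from the topology of the space and the relation alone, so a conjugacy
  \<open>\<phi>\<close> transports it by acting on each coordinate.  Coordinatewise application of \<open>\<phi>\<close> is a
  bijection of the powers of the two spaces (and a homeomorphism of the product topologies); as
  \<open>\<phi>\<close> preserves and reflects the relation, it takes each Mahavier product of \<open>G\<close> onto the
  corresponding one of \<open>H\<close> (\<open>coordwise_image_chains\<close>).  For the infinite product this is the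
  second claim.

  For the entropy, the same bijection takes boxes over an open cover \<open>\<alpha>\<close> to boxes over the open
  cover \<open>{\<phi>(A) : A \<in> \<alpha>}\<close>, so the minimal cardinalities of the covering subfamilies agree for
  every \<open>m\<close> (\<open>min_subcover_image\<close>).  Hence each value \<open>ent(G, \<alpha>)\<close> occurs among
  the values for \<open>H\<close>, which gives \<open>ent(G) \<le> ent(H)\<close>; conjugacy being symmetric, equality
  follows.
\<close>

section \<open>Maps acting on each coordinate\<close>

text \<open>
  The restriction to \<open>I\<close> returns \<open>undefined\<close> off \<open>I\<close>, so that values are points of the
  extensional products that carry the product topology.
\<close>

definition coordwise :: "('a \<Rightarrow> 'b) \<Rightarrow> 'i set \<Rightarrow> ('i \<Rightarrow> 'a) \<Rightarrow> 'i \<Rightarrow> 'b" where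
  "coordwise f I x = (\<lambda>i\<in>I. f (x i))"

lemma coordwise_image_PiE: "coordwise f I ` PiE I A = PiE I (\<lambda>i. f ` A i)"
proof (intro equalityI subsetI)
  fix y assume "y \<in> coordwise f I ` PiE I A"
  then show "y \<in> PiE I (\<lambda>i. f ` A i)"
    by (auto simp: coordwise_def)
next
  fix y assume y: "y \<in> PiE I (\<lambda>i. f ` A i)"
  then have "\<forall>i\<in>I. \<exists>a. a \<in> A i \<and> f a = y i"
    by (force simp: PiE_iff)
  then obtain x where x: "\<forall>i\<in>I. x i \<in> A i \<and> f (x i) = y i"
    by metis
  have "y = coordwise f I (restrict x I)"
    using x y by (auto simp: coordwise_def PiE_iff extensional_def)
  moreover have "restrict x I \<in> PiE I A"
    using x by auto
  ultimately show "y \<in> coordwise f I ` PiE I A"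
    by blast
qed

lemma inj_on_coordwise:
  assumes "inj_on f A"
  shows "inj_on (coordwise f I) (I \<rightarrow>\<^sub>E A)"
proof (rule inj_onI)
  fix x y assume x: "x \<in> I \<rightarrow>\<^sub>E A" and y: "y \<in> I \<rightarrow>\<^sub>E A"
    and eq: "coordwise f I x = coordwise f I y"
  show "x = y"
  proof (rule PiE_ext[OF x y])
    fix i assume i: "i \<in> I"
    then have "f (x i) = f (y i)"
      using fun_cong[OF eq, of i] by (simp add: coordwise_def)
    then show "x i = y i"
      using assms i x y by (meson PiE_mem inj_onD)
  qed
qed

lemma continuous_map_coordwise:
  assumes "continuous_map T S f"
  shows "continuous_map (product_topology (\<lambda>_. T) I) (product_topology (\<lambda>_. S) I)
           (coordwise f I)"
proof -
  have "continuous_map (product_topology (\<lambda>_. T) I) S (\<lambda>x. f (x k))" if "k \<in> I" for k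
    using continuous_map_compose[OF continuous_map_product_projection[OF that] assms]
    by (simp add: o_def)
  then show ?thesis
    by (auto simp: continuous_map_componentwise coordwise_def)
qed

lemma homeomorphic_map_coordwise:
  assumes "homeomorphic_map T S f"
  shows "homeomorphic_map (product_topology (\<lambda>_. T) I) (product_topology (\<lambda>_. S) I)
           (coordwise f I)"
proof -
  obtain g where g: "homeomorphic_maps T S f g"
    using assms homeomorphic_map_maps by blast
  then have "continuous_map T S f" "continuous_map S T g"
    by (auto simp: homeomorphic_maps_def)
  then have "homeomorphic_maps (product_topology (\<lambda>_. T) I) (product_topology (\<lambda>_. S) I)
      (coordwise f I) (coordwise g I)"
    using g unfolding homeomorphic_maps_def
    by (auto simp: continuous_map_coordwise)
      (auto simp: coordwise_def fun_eq_iff PiE_iff extensional_def)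
  then show ?thesis
    by (rule homeomorphic_maps_imp_map)
qed

text \<open>
  With \<open>I\<close> the set of coordinates and \<open>J\<close> the set of positions at which a step of the relation
  is required, this covers the finite and the infinite Mahavier products at once.
\<close>

lemma coordwise_image_chains:
  assumes onto: "f ` A = B"
    and rel: "\<And>x y. x \<in> A \<Longrightarrow> y \<in> A \<Longrightarrow> (x, y) \<in> G \<longleftrightarrow> (f x, f y) \<in> H"
    and J: "J \<subseteq> I" "\<And>i::nat. i \<in> J \<Longrightarrow> i + 1 \<in> I"
  shows "coordwise f I ` {x \<in> I \<rightarrow>\<^sub>E A. \<forall>i\<in>J. (x (i+1), x i) \<in> G} =
         {y \<in> I \<rightarrow>\<^sub>E B. \<forall>i\<in>J. (y (i+1), y i) \<in> H}"
proof -
  have chain_iff: "(\<forall>i\<in>J. (coordwise f I x (i+1), coordwise f I x i) \<in> H) \<longleftrightarrow>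
      (\<forall>i\<in>J. (x (i+1), x i) \<in> G)" if "x \<in> I \<rightarrow>\<^sub>E A" for x
  proof (rule ball_cong[OF refl])
    fix i assume "i \<in> J"
    then have "i \<in> I" "i + 1 \<in> I"
      using J by auto
    then show "(coordwise f I x (i+1), coordwise f I x i) \<in> H \<longleftrightarrow> (x (i+1), x i) \<in> G"
      using rel[of "x (i+1)" "x i"] PiE_mem[OF that] by (simp add: coordwise_def)
  qed
  have "{y \<in> coordwise f I ` (I \<rightarrow>\<^sub>E A). \<forall>i\<in>J. (y (i+1), y i) \<in> H} =
      coordwise f I ` {x \<in> I \<rightarrow>\<^sub>E A. \<forall>i\<in>J. (coordwise f I x (i+1), coordwise f I x i) \<in> H}"
    by blast
  then show ?thesis
    using chain_iff onto by (simp add: coordwise_image_PiE cong: conj_cong)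
qed

section \<open>Entropy with respect to an open cover\<close>

lemma cover_power_image:
  "cover_power ((`) f ` \<alpha>) n = (`) (coordwise f {1..n}) ` cover_power \<alpha> n"
proof (intro equalityI subsetI)
  fix Q assume "Q \<in> cover_power ((`) f ` \<alpha>) n"
  then obtain B where Q: "Q = PiE {1..n} B" and B: "\<forall>j\<in>{1..n}. B j \<in> (`) f ` \<alpha>"
    unfolding cover_power_def by blast
  from B have "\<forall>j\<in>{1..n}. \<exists>A. A \<in> \<alpha> \<and> B j = f ` A"
    by (simp add: image_iff Bex_def)
  from bchoice[OF this]
  obtain A where A: "\<forall>j\<in>{1..n}. A j \<in> \<alpha> \<and> B j = f ` A j"
    by (rule exE)
  have "Q = coordwise f {1..n} ` PiE {1..n} A"
    unfolding coordwise_image_PiE Q by (rule PiE_cong) (use A in blast)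
  moreover have "PiE {1..n} A \<in> cover_power \<alpha> n"
    using A unfolding cover_power_def by blast
  ultimately show "Q \<in> (`) (coordwise f {1..n}) ` cover_power \<alpha> n"
    by (rule image_eqI)
next
  fix Q assume "Q \<in> (`) (coordwise f {1..n}) ` cover_power \<alpha> n"
  then obtain A where Q: "Q = coordwise f {1..n} ` PiE {1..n} A"
    and A: "\<forall>j\<in>{1..n}. A j \<in> \<alpha>"
    unfolding cover_power_def by blast
  have "\<forall>j\<in>{1..n}. f ` A j \<in> (`) f ` \<alpha>"
    using A by simp
  then show "Q \<in> cover_power ((`) f ` \<alpha>) n"
    unfolding cover_power_def Q coordwise_image_PiE
    by (intro CollectI exI[of _ "\<lambda>j. f ` A j"] conjI) (simp_all only:)
qed

text \<open>
  Taking images under an injective map is a cardinality-preserving bijection between the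
  subfamilies of \<open>\<C>\<close> and those of its image, and it preserves and reflects the covering
  property.  So the two minima range over the same set of numbers.
\<close>

lemma min_subcover_image:
  assumes inj: "inj_on f D" and K: "K \<subseteq> D" and C: "\<Union>\<C> \<subseteq> D"
  shows "min_subcover (f ` K) ((`) f ` \<C>) = min_subcover K \<C>"
proof -
  have inj_sets: "inj_on ((`) f) \<C>"
    using C by (intro inj_on_subset[OF inj_on_image_Pow[OF inj]]) auto
  have covers_iff: "f ` K \<subseteq> \<Union>((`) f ` \<B>) \<longleftrightarrow> K \<subseteq> \<Union>\<B>" if "\<B> \<subseteq> \<C>" for \<B>
  proof -
    have "\<Union>\<B> \<subseteq> D"
      using that C by blast
    then show ?thesis
      unfolding image_Union[symmetric] by (rule inj_on_image_subset_iff[OF inj K])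
  qed
  have "(\<exists>\<B>. \<B> \<subseteq> (`) f ` \<C> \<and> finite \<B> \<and> card \<B> = k \<and> f ` K \<subseteq> \<Union>\<B>) \<longleftrightarrow>
        (\<exists>\<B>. \<B> \<subseteq> \<C> \<and> finite \<B> \<and> card \<B> = k \<and> K \<subseteq> \<Union>\<B>)" (is "?L \<longleftrightarrow> ?R") for k
  proof
    assume ?L
    then obtain \<B> where B: "\<B> \<subseteq> \<C>" "finite ((`) f ` \<B>)" "card ((`) f ` \<B>) = k"
        "f ` K \<subseteq> \<Union>((`) f ` \<B>)"
      unfolding subset_image_iff by blast
    have "inj_on ((`) f) \<B>"
      using inj_sets B(1) by (rule inj_on_subset)
    then have "finite \<B>" "card \<B> = k"
      using B(2,3) by (simp_all add: finite_image_iff card_image)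
    moreover have "K \<subseteq> \<Union>\<B>"
      using B(4) covers_iff[OF B(1)] by (rule iffD1[rotated])
    ultimately show ?R
      using B(1) by (intro exI[of _ \<B>] conjI)
  next
    assume ?R
    then obtain \<B> where B: "\<B> \<subseteq> \<C>" "finite \<B>" "card \<B> = k" "K \<subseteq> \<Union>\<B>"
      by blast
    have "inj_on ((`) f) \<B>"
      using inj_sets B(1) by (rule inj_on_subset)
    then have "card ((`) f ` \<B>) = k"
      using B by (simp add: card_image)
    then show ?L
      using B covers_iff[OF B(1)]
      by (intro exI[of _ "(`) f ` \<B>"] conjI image_mono finite_imageI) simp_all
  qed
  then show ?thesis
    unfolding min_subcover_def by simp
qed

lemma open_cover_image:
  assumes "homeomorphic_map T S f" and "open_cover T \<alpha>"
  shows "open_cover S ((`) f ` \<alpha>)"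
proof -
  have "openin S (f ` A)" if "A \<in> \<alpha>" for A
    using assms that by (auto simp: open_cover_def homeomorphic_map_openness_eq)
  moreover have "\<Union>((`) f ` \<alpha>) = topspace S"
    using assms homeomorphic_imp_surjective_map[OF assms(1)]
    by (simp add: open_cover_def flip: image_Union)
  ultimately show ?thesis
    by (auto simp: open_cover_def)
qed

lemma ent_cover_image:
  assumes f: "homeomorphic_map T S f"
    and rel: "\<And>x y. x \<in> topspace T \<Longrightarrow> y \<in> topspace T \<Longrightarrow> (x, y) \<in> G \<longleftrightarrow> (f x, f y) \<in> H"
    and \<alpha>: "open_cover T \<alpha>"
  shows "ent_cover S H ((`) f ` \<alpha>) = ent_cover T G \<alpha>"
proof -
  have "min_subcover (mahavier_inv S H m) (cover_power ((`) f ` \<alpha>) (m+1)) =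
        min_subcover (mahavier_inv T G m) (cover_power \<alpha> (m+1))" for m
  proof -
    let ?D = "{1..m+1} \<rightarrow>\<^sub>E topspace T"
    have products: "mahavier_inv S H m = coordwise f {1..m+1} ` mahavier_inv T G m"
      unfolding mahavier_inv_def
      by (rule coordwise_image_chains[OF homeomorphic_imp_surjective_map[OF f] rel, symmetric])
        auto
    have "P \<subseteq> ?D" if "P \<in> cover_power \<alpha> (m+1)" for P
    proof -
      obtain A where "P = PiE {1..m+1} A" "\<forall>j\<in>{1..m+1}. A j \<in> \<alpha>"
        using \<open>P \<in> cover_power \<alpha> (m+1)\<close> unfolding cover_power_def by blast
      moreover have "\<forall>A\<in>\<alpha>. A \<subseteq> topspace T"
        using \<alpha> by (auto simp: open_cover_def)
      ultimately show ?thesis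
        using PiE_mono[of "{1..m+1}" A "\<lambda>_. topspace T"] by blast
    qed
    then have "\<Union>(cover_power \<alpha> (m+1)) \<subseteq> ?D"
      by blast
    moreover have "mahavier_inv T G m \<subseteq> ?D"
      by (auto simp: mahavier_inv_def)
    ultimately show ?thesis
      unfolding products cover_power_image
      by (intro min_subcover_image[OF inj_on_coordwise[OF homeomorphic_imp_injective_map[OF f]]])
  qed
  then show ?thesis
    by (simp add: ent_cover_def)
qed

section \<open>Conjugate relations\<close>

lemma topological_conjugates_sym:
  assumes "topological_conjugates T G S H"
  shows "topological_conjugates S H T G"
proof -
  obtain f where f: "homeomorphic_map T S f"
    and rel: "\<forall>x\<in>topspace T. \<forall>y\<in>topspace T. (x, y) \<in> G \<longleftrightarrow> (f x, f y) \<in> H"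
    using assms unfolding topological_conjugates_def by blast
  obtain g where "homeomorphic_maps T S f g"
    using f homeomorphic_map_maps by blast
  then have g: "homeomorphic_map S T g" and fg: "\<forall>y\<in>topspace S. f (g y) = y"
    by (auto simp: homeomorphic_maps_map)
  have "g y \<in> topspace T" if "y \<in> topspace S" for y
    using homeomorphic_imp_surjective_map[OF g] that by blast
  then show ?thesis
    using g fg rel unfolding topological_conjugates_def by (intro exI[of _ g]) auto
qed

text \<open>
  Conjugacy constrains the relations only on pairs of points of the spaces.  Closedness confines
  them to such pairs, so that conjugate relations are empty together; this matters because the
  entropy of the empty relation is set separately.
\<close>

lemma empty_if_conjugate_empty:
  assumes conj: "topological_conjugates T G S {}" and G: "closed_relation T G"
  shows "G = {}"
proof -
  have "G \<subseteq> topspace T \<times> topspace T"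
    using G closedin_subset unfolding closed_relation_def by fastforce
  then show ?thesis
    using conj unfolding topological_conjugates_def by auto
qed

lemma conjugate_closed_relation_empty_iff:
  assumes "topological_conjugates T G S H" "closed_relation T G" "closed_relation S H"
  shows "G = {} \<longleftrightarrow> H = {}"
proof
  assume "G = {}"
  then show "H = {}"
    using empty_if_conjugate_empty topological_conjugates_sym[OF assms(1)] assms(3) by blast
next
  assume "H = {}"
  then show "G = {}"
    using empty_if_conjugate_empty assms(1,2) by blast
qed

lemma ent_le_conjugate:
  assumes conj: "topological_conjugates T G S H"
    and G: "closed_relation T G" and H: "closed_relation S H"
  shows "ent T G \<le> ent S H"
proof (cases "G = {}")
  case True
  then show ?thesis
    using conjugate_closed_relation_empty_iff[OF assms] by (simp add: ent_def)
next
  case False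
  then have "H \<noteq> {}"
    using conjugate_closed_relation_empty_iff[OF assms] by simp
  obtain f where f: "homeomorphic_map T S f"
    and rel: "\<And>x y. x \<in> topspace T \<Longrightarrow> y \<in> topspace T \<Longrightarrow> (x, y) \<in> G \<longleftrightarrow> (f x, f y) \<in> H"
    using conj unfolding topological_conjugates_def by blast
  have "(SUP \<alpha>\<in>{\<alpha>. open_cover T \<alpha>}. ereal (ent_cover T G \<alpha>)) \<le>
        (SUP \<beta>\<in>{\<beta>. open_cover S \<beta>}. ereal (ent_cover S H \<beta>))"
  proof (rule SUP_mono)
    fix \<alpha> assume "\<alpha> \<in> {\<alpha>. open_cover T \<alpha>}"
    then have \<alpha>: "open_cover T \<alpha>"
      by simp
    show "\<exists>\<beta>\<in>{\<beta>. open_cover S \<beta>}. ereal (ent_cover T G \<alpha>) \<le> ereal (ent_cover S H \<beta>)"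
      using open_cover_image[OF f \<alpha>] ent_cover_image[OF f rel \<alpha>]
      by (intro bexI[of _ "(`) f ` \<alpha>"]) auto
  qed
  then show ?thesis
    using \<open>G \<noteq> {}\<close> \<open>H \<noteq> {}\<close> by (simp add: ent_def)
qed

lemma mahavier_inv_inf_chains:
  "mahavier_inv_inf T G = {x \<in> {1..} \<rightarrow>\<^sub>E topspace T. \<forall>i\<in>{1..}. (x (i+1), x i) \<in> G}"
  by (auto simp: mahavier_inv_inf_def)

lemma mahavier_inv_inf_homeomorphic:
  assumes "topological_conjugates T G S H"
  shows "mahavier_inv_inf_topology T G homeomorphic_space mahavier_inv_inf_topology S H"
proof -
  obtain f where f: "homeomorphic_map T S f"
    and rel: "\<And>x y. x \<in> topspace T \<Longrightarrow> y \<in> topspace T \<Longrightarrow> (x, y) \<in> G \<longleftrightarrow> (f x, f y) \<in> H"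
    using assms unfolding topological_conjugates_def by blast
  let ?P = "\<lambda>T. product_topology (\<lambda>_::nat. T) {1..}"
  have "coordwise f {1..} ` mahavier_inv_inf T G = mahavier_inv_inf S H"
    unfolding mahavier_inv_inf_chains
    by (rule coordwise_image_chains[OF homeomorphic_imp_surjective_map[OF f] rel]) auto
  moreover have "topspace (?P T) \<inter> mahavier_inv_inf T G = mahavier_inv_inf T G"
    "topspace (?P S) \<inter> mahavier_inv_inf S H = mahavier_inv_inf S H"
    by (auto simp: mahavier_inv_inf_def)
  ultimately have "homeomorphic_map (mahavier_inv_inf_topology T G)
      (mahavier_inv_inf_topology S H) (coordwise f {1..})"
    unfolding mahavier_inv_inf_topology_def
    by (intro homeomorphic_map_subtopologies homeomorphic_map_coordwise f) simp
  then show ?thesis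
    by (rule homeomorphic_map_imp_homeomorphic_space)
qed

theorem theorem5p9:
  fixes X :: "'a metric" and Y :: "'b metric"
    and G :: "('a \<times> 'a) set" and H :: "('b \<times> 'b) set"
  assumes "compact_space (mtopology_of X)"
    and "compact_space (mtopology_of Y)"
    and "closed_relation (mtopology_of X) G"
    and "closed_relation (mtopology_of Y) H"
    and "topological_conjugates (mtopology_of X) G (mtopology_of Y) H"
  shows "ent (mtopology_of X) G = ent (mtopology_of Y) H \<and>
         mahavier_inv_inf_topology (mtopology_of X) G homeomorphic_space
         mahavier_inv_inf_topology (mtopology_of Y) H"
proof
  show "ent (mtopology_of X) G = ent (mtopology_of Y) H"
    using ent_le_conjugate[OF assms(5,3,4)]
      ent_le_conjugate[OF topological_conjugates_sym[OF assms(5)] assms(4,3)]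
    by (rule antisym)
  show "mahavier_inv_inf_topology (mtopology_of X) G homeomorphic_space
      mahavier_inv_inf_topology (mtopology_of Y) H"
    using assms(5) by (rule mahavier_inv_inf_homeomorphic)
qed

end
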